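(* For integers $n\geq b\geq 1$, the number $d_b(n)$ of $(n,b)$-domino towers equals $\binom{2n-1}{n-b}$.
   Context: A domino is a horizontal $2\times1$ block occupying cells $(x,y),(x+1,y)$ of the integer grid; $y$ is its level and $\{x,x+1\}$ its column set. For $n\ge b\ge1$, an $(n,b)$-domino tower is a finite set of $n$ pairwise non-overlapping horizontal dominoes such that: (i) exactly $b$ of them (the base) lie at level $0$, occupying a contiguous horizontal run of $2b$ cells; (ii) the remaining $n-b$ dominoes lie at levels $\ge 1$, and whenever a non-base domino occupies $\{(x,y),(x+1,y)\}$ there is a domino in one of the positions $\{(x-1,y-1),(x,y-1)\}$, $\{(x,y-1),(x+1,y-1)\}$, $\{(x+1,y-1),(x+2,y-1)\}$. Towers are considered as fixed polyominoes, i.e. up to horizontal translation. *)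

theory Defs
  imports "HOL-Library.Disjoint_Sets"
begin

type_synonym cell = "int \<times> int"

definition domino :: "int \<Rightarrow> int \<Rightarrow> cell set" where
  "domino x y = {(x, y), (x + 1, y)}"

text \<open>
  A tower is a set of dominoes, each domino being its set of two cells; hence pairwise
  non-overlapping is \<^const>\<open>disjoint\<close>.
\<close>

definition base :: "cell set set \<Rightarrow> cell set set" where
  "base T = {domino x 0 | x. domino x 0 \<in> T}"

definition domino_tower :: "nat \<Rightarrow> nat \<Rightarrow> cell set set \<Rightarrow> bool" where
  "domino_tower n b T \<longleftrightarrow>
     finite T \<and> card T = n \<and>
     (\<forall>D\<in>T. \<exists>x y. D = domino x y) \<and>
     disjoint T \<and>
     card (base T) = b \<and>
     (\<exists>a. \<Union> (base T) = {a..<a + 2 * int b} \<times> {0}) \<and>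
     (\<forall>x y. domino x y \<in> T - base T \<longrightarrow>
        y \<ge> 1 \<and>
        (domino (x - 1) (y - 1) \<in> T \<or> domino x (y - 1) \<in> T \<or> domino (x + 1) (y - 1) \<in> T))"

definition htranslate :: "int \<Rightarrow> cell set set \<Rightarrow> cell set set" where
  "htranslate k T = (\<lambda>D. (\<lambda>(x, y). (x + k, y)) ` D) ` T"

definition htranslation_rel :: "nat \<Rightarrow> nat \<Rightarrow> (cell set set \<times> cell set set) set" where
  "htranslation_rel n b =
     {(S, T). domino_tower n b S \<and> domino_tower n b T \<and> (\<exists>k. T = htranslate k S)}"

definition num_domino_towers :: "nat \<Rightarrow> nat \<Rightarrow> nat" where
  "num_domino_towers b n = card ({T. domino_tower n b T} // htranslation_rel n b)"

end

(*
  Pushing the pieces of a tower down one at a time identifies towers with heaps of dimers on the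
  integers (Viennot), where two dimers do not commute exactly when their columns differ by at most 1.
  Removing the rightmost piece that has nothing above it, again and again, yields a normal form: heaps
  correspond to words of columns in which every letter is at least its predecessor minus 1. In such a
  word the base pieces are the letters exceeding all earlier letters by at least 2. Counting the
  continuations of a prefix only needs the number r of missing base pieces and the distance h of the
  last letter from the maximum: by the hockey-stick identity, there are (2m + 1 + h choose m - r)
  continuations by m letters. Prescribing the base {0, 2, ..., 2b - 2} selects one tower from each
  translation class of towers.
*)

theory Submission
  imports Defs
begin

section \<open>Heaps of dimers and dropped pieces\<close>

text \<open>A point \<open>(x, y)\<close> stands for the domino with left cell
  \<open>(x, y)\<close>, so two pieces share a column exactly when their first coordinates differ by
  at most 1. The inserted \<open>0\<close> is the floor.\<close>

definition drop_level :: "cell set \<Rightarrow> int \<Rightarrow> int" where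
  "drop_level P x = Max (insert 0 ((\<lambda>(x', y). y + 1) ` {(x', y) \<in> P. \<bar>x' - x\<bar> \<le> 1}))"

definition heap :: "cell set \<Rightarrow> bool" where
  "heap P \<longleftrightarrow> finite P \<and>
     (\<forall>x y. (x, y) \<in> P \<longrightarrow> 0 \<le> y \<and> (0 < y \<longrightarrow> (\<exists>x'. \<bar>x' - x\<bar> \<le> 1 \<and> (x', y - 1) \<in> P))) \<and>
     (\<forall>x x' y. (x, y) \<in> P \<longrightarrow> (x', y) \<in> P \<longrightarrow> \<bar>x' - x\<bar> \<le> 1 \<longrightarrow> x' = x)"

lemma heapD:
  assumes "heap P"
  shows "finite P" "(x, y) \<in> P \<Longrightarrow> 0 \<le> y"
    "(x, y) \<in> P \<Longrightarrow> 0 < y \<Longrightarrow> \<exists>x'. \<bar>x' - x\<bar> \<le> 1 \<and> (x', y - 1) \<in> P"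
    "(x, y) \<in> P \<Longrightarrow> (x', y) \<in> P \<Longrightarrow> \<bar>x' - x\<bar> \<le> 1 \<Longrightarrow> x' = x"
  using assms unfolding heap_def by blast+

lemma drop_level:
  assumes "finite P"
  shows drop_level_nonneg: "0 \<le> drop_level P x"
    and drop_level_gt: "(x', y) \<in> P \<Longrightarrow> \<bar>x' - x\<bar> \<le> 1 \<Longrightarrow> y < drop_level P x"
    and drop_level_cases: "drop_level P x = 0 \<or> (\<exists>x'. \<bar>x' - x\<bar> \<le> 1 \<and> (x', drop_level P x - 1) \<in> P)"
proof -
  let ?A = "insert 0 ((\<lambda>(x', y). y + 1) ` {(x', y) \<in> P. \<bar>x' - x\<bar> \<le> 1})"
  have fin: "finite ?A"
    by (intro finite.insertI finite_imageI finite_subset[OF _ assms]) auto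
  show "0 \<le> drop_level P x"
    unfolding drop_level_def by (rule Max_ge[OF fin]) simp
  show "y < drop_level P x" if "(x', y) \<in> P" "\<bar>x' - x\<bar> \<le> 1"
  proof -
    have "y + 1 \<in> ?A" using that by force
    then have "y + 1 \<le> drop_level P x"
      unfolding drop_level_def using Max_ge[OF fin] by blast
    then show ?thesis by simp
  qed
  have "drop_level P x \<in> ?A"
    unfolding drop_level_def by (rule Max_in[OF fin]) simp
  then show "drop_level P x = 0 \<or> (\<exists>x'. \<bar>x' - x\<bar> \<le> 1 \<and> (x', drop_level P x - 1) \<in> P)"
    by auto
qed

lemma drop_level_eq_0_iff:
  assumes "heap P"
  shows "drop_level P x = 0 \<longleftrightarrow> (\<forall>(x', y) \<in> P. 1 < \<bar>x' - x\<bar>)"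
  using drop_level_gt[OF heapD(1)[OF assms], of _ _ x] heapD(2)[OF assms]
    drop_level_cases[OF heapD(1)[OF assms], of x]
  by (smt (verit, ccfv_threshold) case_prodI2 case_prodE case_prodD)

lemma drop_level_fresh:
  assumes "finite P"
  shows "(x, drop_level P x) \<notin> P"
  using drop_level_gt[OF assms, of x "drop_level P x" x] by auto

lemma heap_drop:
  assumes "heap P"
  shows "heap (insert (x, drop_level P x) P)"
proof -
  note fin = heapD(1)[OF assms]
  show ?thesis
    unfolding heap_def
  proof (intro conjI allI impI)
    show "finite (insert (x, drop_level P x) P)" using fin by simp
  next
    fix z y assume "(z, y) \<in> insert (x, drop_level P x) P"
    then show "0 \<le> y" using heapD(2)[OF assms] drop_level_nonneg[OF fin] by auto
  next
    fix z y assume "(z, y) \<in> insert (x, drop_level P x) P" "0 < y"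
    then show "\<exists>x'. \<bar>x' - z\<bar> \<le> 1 \<and> (x', y - 1) \<in> insert (x, drop_level P x) P"
      using heapD(3)[OF assms] drop_level_cases[OF fin, of x] by fastforce
  next
    fix z z' y
    assume "(z, y) \<in> insert (x, drop_level P x) P" "(z', y) \<in> insert (x, drop_level P x) P"
      "\<bar>z' - z\<bar> \<le> 1"
    then show "z' = z"
      using heapD(4)[OF assms] drop_level_gt[OF fin, of _ _ x] by fastforce
  qed
qed

section \<open>Words of columns as normal forms of heaps\<close>

text \<open>A word lists the columns of successively dropped pieces, the most recent one first.\<close>

fun pile :: "int list \<Rightarrow> cell set" where
  "pile [] = {}"
| "pile (x # w) = insert (x, drop_level (pile w) x) (pile w)"

text \<open>As the latest letter comes first, \<open>y\<close> is dropped just before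
  \<open>x\<close>.\<close>

abbreviation normal :: "int list \<Rightarrow> bool" where
  "normal \<equiv> successively (\<lambda>x y. y \<le> x + 1)"

lemma heap_pile: "heap (pile w)"
proof (induction w)
  case Nil
  then show ?case by (simp add: heap_def)
next
  case (Cons x w)
  then show ?case by (simp add: heap_drop)
qed

lemmas finite_pile = heapD(1)[OF heap_pile]

lemma card_pile: "card (pile w) = length w"
  by (induction w) (auto simp: finite_pile drop_level_fresh)

lemma fst_pile: "fst ` pile w = set w"
  by (induction w) auto

definition top_piece :: "cell set \<Rightarrow> cell \<Rightarrow> bool" where
  "top_piece P p \<longleftrightarrow> p \<in> P \<and> (\<forall>(x', y') \<in> P. \<bar>x' - fst p\<bar> \<le> 1 \<longrightarrow> y' \<le> snd p)"

text \<open>Each top bounds the level of the other, so the levels agree; distinct pieces on one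
  level share no column.\<close>

lemma top_near:
  assumes "heap P" "top_piece P (x, y)" "top_piece P (x', y')" "\<bar>x' - x\<bar> \<le> 1"
  shows "x' = x" "y' = y"
proof -
  have "y' \<le> y" "y \<le> y'"
    using assms(2-4) unfolding top_piece_def by fastforce+
  then show "y' = y" by simp
  then show "x' = x"
    using assms heapD(4)[OF assms(1), of x y x'] unfolding top_piece_def by auto
qed

lemma top_drop:
  assumes "finite P"
  shows "top_piece (insert (x, drop_level P x) P) (x, drop_level P x)"
  using drop_level_gt[OF assms, of _ _ x] unfolding top_piece_def by fastforce

text \<open>A top right of \<open>x\<close> is at least 2 columns away from the last piece, so it is
  already a top of the pile without that piece. By induction its column is at most the previous
  letter, hence at most \<open>x + 1\<close>, which is too small.\<close>

lemma top_normal_le_hd: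
  assumes "normal (x # w)" "top_piece (pile (x # w)) (z, y)"
  shows "z \<le> x"
  using assms
proof (induction w arbitrary: x z y)
  case Nil
  then show ?case by (auto simp: top_piece_def)
next
  case (Cons x' w)
  note heap = heap_pile[of "x # x' # w"]
  have top_x: "top_piece (pile (x # x' # w)) (x, drop_level (pile (x' # w)) x)"
    using top_drop[OF finite_pile[of "x' # w"], of x] by simp
  show ?case
  proof (rule ccontr)
    assume "\<not> z \<le> x"
    then have "1 < \<bar>z - x\<bar>"
      using top_near(1)[OF heap top_x Cons.prems(2)] by linarith
    have "top_piece (pile (x' # w)) (z, y)"
      using Cons.prems(2) \<open>\<not> z \<le> x\<close> unfolding top_piece_def by auto
    then have "z \<le> x'"
      using Cons.IH[of x'] Cons.prems(1) by (auto simp: successively_Cons)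
    then show False
      using Cons.prems(1) \<open>1 < \<bar>z - x\<bar>\<close> \<open>\<not> z \<le> x\<close> by (auto simp: successively_Cons)
  qed
qed

text \<open>The pile determines the last letter as the column of its rightmost top; removing that
  piece leads to shorter words.\<close>

lemma pile_inj:
  assumes "normal v" "normal w" "pile v = pile w"
  shows "v = w"
  using assms
proof (induction v arbitrary: w)
  case Nil
  then show ?case by (cases w) auto
next
  case (Cons x v)
  then obtain x' w' where w: "w = x' # w'" by (cases w) auto
  have eq: "insert (x, drop_level (pile v) x) (pile v) = insert (x', drop_level (pile w') x') (pile w')"
    using Cons.prems(3) w by simp
  have t: "top_piece (pile (x # v)) (x, drop_level (pile v) x)"
    "top_piece (pile (x' # w')) (x', drop_level (pile w') x')"
    using top_drop[OF finite_pile] by simp_all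
  have "x \<le> x'" "x' \<le> x"
    using top_normal_le_hd Cons.prems t unfolding w by metis+
  then have xx: "x' = x" by simp
  have "drop_level (pile w') x' = drop_level (pile v) x"
    using top_near(2)[OF heap_pile t(1), of x'] t(2) Cons.prems(3) xx unfolding w by simp
  then have "pile v = pile w'"
    using eq xx drop_level_fresh[OF finite_pile] by (metis insert_ident)
  then show ?case
    using Cons.IH[of w'] Cons.prems xx unfolding w by (auto simp: successively_Cons)
qed

lemma drop_level_eqI:
  assumes "finite P" "0 \<le> y"
    and "\<And>x' y'. (x', y') \<in> P \<Longrightarrow> \<bar>x' - x\<bar> \<le> 1 \<Longrightarrow> y' < y"
    and "0 < y \<Longrightarrow> \<exists>x'. \<bar>x' - x\<bar> \<le> 1 \<and> (x', y - 1) \<in> P"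
  shows "drop_level P x = y"
proof (rule antisym)
  show "drop_level P x \<le> y"
    using drop_level_cases[OF assms(1), of x] assms(2,3) by force
  show "y \<le> drop_level P x"
    using assms(2,4) drop_level_gt[OF assms(1), of _ "y - 1" x] drop_level_nonneg[OF assms(1), of x]
    by fastforce
qed

text \<open>No piece rests on a top, so the other pieces stay supported, and the removed piece falls
  back to its old level when dropped again.\<close>

lemma heap_remove_top:
  assumes "heap P" "top_piece P (x, y)"
  shows "heap (P - {(x, y)})" "drop_level (P - {(x, y)}) x = y"
proof -
  have near: "y' \<le> y" if "(x', y') \<in> P" "\<bar>x' - x\<bar> \<le> 1" for x' y'
    using assms(2) that unfolding top_piece_def by auto
  show "heap (P - {(x, y)})"
    unfolding heap_def
  proof (intro conjI allI impI)
    show "finite (P - {(x, y)})" using heapD(1)[OF assms(1)] by simp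
  next
    fix z v assume "(z, v) \<in> P - {(x, y)}"
    then show "0 \<le> v" using heapD(2)[OF assms(1)] by auto
  next
    fix z v assume *: "(z, v) \<in> P - {(x, y)}" "0 < v"
    then obtain x' where x': "\<bar>x' - z\<bar> \<le> 1" "(x', v - 1) \<in> P"
      using heapD(3)[OF assms(1), of z v] by auto
    \<comment> \<open>Otherwise \<open>(z, v)\<close> would lie above the top \<open>(x, y)\<close>
      and share a column with it.\<close>
    then have "(x', v - 1) \<noteq> (x, y)"
      using near[of z v] * by (auto simp: abs_minus_commute)
    then show "\<exists>x'. \<bar>x' - z\<bar> \<le> 1 \<and> (x', v - 1) \<in> P - {(x, y)}"
      using x' by auto
  next
    fix z z' v
    assume "(z, v) \<in> P - {(x, y)}" "(z', v) \<in> P - {(x, y)}" "\<bar>z' - z\<bar> \<le> 1"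
    then show "z' = z" using heapD(4)[OF assms(1)] by blast
  qed
  have P: "(x, y) \<in> P" using assms(2) by (simp add: top_piece_def)
  show "drop_level (P - {(x, y)}) x = y"
  proof (rule drop_level_eqI)
    show "finite (P - {(x, y)})" using heapD(1)[OF assms(1)] by simp
    show "0 \<le> y" using heapD(2)[OF assms(1)] P by blast
    show "y' < y" if "(x', y') \<in> P - {(x, y)}" "\<bar>x' - x\<bar> \<le> 1" for x' y'
      using that near[of x' y'] heapD(4)[OF assms(1) P, of x'] by force
    show "\<exists>x'. \<bar>x' - x\<bar> \<le> 1 \<and> (x', y - 1) \<in> P - {(x, y)}" if "0 < y"
      using heapD(3)[OF assms(1) P that] by auto
  qed
qed

lemma ex_rightmost_top:
  assumes "finite P" "P \<noteq> {}"
  obtains p where "top_piece P p" "\<And>q. top_piece P q \<Longrightarrow> fst q \<le> fst p"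
proof -
  \<comment> \<open>A piece of maximal level is a top, so there are tops to choose from.\<close>
  let ?y = "Max (snd ` P)"
  have "?y \<in> snd ` P" using assms by (intro Max_in) auto
  then obtain q where "q \<in> P" "snd q = ?y" by auto
  then have "top_piece P q"
    using assms(1) unfolding top_piece_def by (force intro: Max_ge)
  then have ne: "Collect (top_piece P) \<noteq> {}" by blast
  have fin: "finite (Collect (top_piece P))"
    by (rule finite_subset[OF _ assms(1)]) (auto simp: top_piece_def)
  have "Max (fst ` Collect (top_piece P)) \<in> fst ` Collect (top_piece P)"
    using ne fin by (intro Max_in) auto
  then obtain p where "top_piece P p" "fst p = Max (fst ` Collect (top_piece P))" by auto
  then show thesis
    using that[of p] fin by (metis Max_ge finite_imageI image_eqI mem_Collect_eq)
qed

text \<open>The column of the rightmost top serves as last letter; the induction hypothesis yields a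
  word for the rest.\<close>

lemma pile_surj:
  assumes "heap P"
  shows "\<exists>w. normal w \<and> pile w = P"
  using assms
proof (induction "card P" arbitrary: P)
  case 0
  then show ?case using heapD(1) by (intro exI[of _ "[]"]) auto
next
  case (Suc n)
  note fin = heapD(1)[OF Suc.prems]
  have "P \<noteq> {}" using Suc.hyps(2) by auto
  then obtain x y where t: "top_piece P (x, y)" and right: "\<And>q. top_piece P q \<Longrightarrow> fst q \<le> x"
    using ex_rightmost_top[OF fin] by (metis fst_conv surj_pair)
  let ?Q = "P - {(x, y)}"
  have P: "(x, y) \<in> P" using t by (simp add: top_piece_def)
  have "n = card ?Q" using Suc.hyps(2) P fin by simp
  then obtain w where w: "normal w" "pile w = ?Q"
    using Suc.hyps(1)[of ?Q] heap_remove_top[OF Suc.prems t] by blast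
  have "pile (x # w) = P"
    using w(2) heap_remove_top(2)[OF Suc.prems t] P by auto
  moreover have "normal (x # w)"
  proof (cases w)
    case (Cons z v)
    let ?d = "drop_level (pile v) z"
    have tz: "top_piece ?Q (z, ?d)"
      using top_drop[OF finite_pile[of v], of z] w(2) Cons by simp
    \<comment> \<open>Beyond \<open>x + 1\<close>, the last piece of the rest is too far from the
      removed piece to be covered by it, so it would be a top of \<open>P\<close> right of the
      rightmost one.\<close>
    have "z \<le> x + 1"
    proof (rule ccontr)
      assume "\<not> z \<le> x + 1"
      then have "top_piece P (z, ?d)" using tz unfolding top_piece_def by auto
      then show False using right[of "(z, ?d)"] \<open>\<not> z \<le> x + 1\<close> by simp
    qed
    then show ?thesis using w(1) Cons by (simp add: successively_Cons)
  qed simp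
  ultimately show ?case by blast
qed

section \<open>Base pieces of normal words\<close>

text \<open>This reads the level-0 columns of the pile off the word: a piece reaches the floor
  exactly when no earlier letter is within distance 1.\<close>

fun ground :: "int list \<Rightarrow> int set" where
  "ground [] = {}"
| "ground (x # w) = (if \<forall>z\<in>set w. 1 < \<bar>z - x\<bar> then {x} else {}) \<union> ground w"

lemma ground_pile: "{x. (x, 0) \<in> pile w} = ground w"
proof (induction w)
  case (Cons x w)
  have "(\<forall>(x', y) \<in> pile w. 1 < \<bar>x' - x\<bar>) \<longleftrightarrow> (\<forall>z\<in>set w. 1 < \<bar>z - x\<bar>)"
    unfolding fst_pile[symmetric] by fastforce
  then have "drop_level (pile w) x = 0 \<longleftrightarrow> (\<forall>z\<in>set w. 1 < \<bar>z - x\<bar>)"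
    using drop_level_eq_0_iff[OF heap_pile] by simp
  then show ?case using Cons.IH by auto
qed simp

text \<open>Going back in time, a normal word rises by at most 1 per letter. Starting at
  \<open>x\<close>, it cannot jump over the forbidden columns \<open>x - 1\<close>,
  \<open>x\<close>, \<open>x + 1\<close> to the right side.\<close>

lemma normal_far_left:
  assumes "normal (x # w)" "\<forall>z\<in>set w. 1 < \<bar>z - x\<bar>"
  shows "\<forall>z\<in>set w. z + 2 \<le> x"
proof -
  have "\<forall>z\<in>set w. z + 2 \<le> x" if "normal w" "w \<noteq> [] \<longrightarrow> hd w \<le> x + 1" "\<forall>z\<in>set w. 1 < \<bar>z - x\<bar>" for w
    using that
  proof (induction w)
    case (Cons a w)
    then have "a + 2 \<le> x" by auto
    then show ?case using Cons by (auto simp: successively_Cons)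
  qed simp
  then show ?thesis using assms by (auto simp: successively_Cons)
qed

lemma ground_Cons_normal:
  assumes "normal (x # w)"
  shows "ground (x # w) = (if \<forall>z\<in>set w. z + 2 \<le> x then {x} else {}) \<union> ground w"
proof -
  have "(\<forall>z\<in>set w. 1 < \<bar>z - x\<bar>) \<longleftrightarrow> (\<forall>z\<in>set w. z + 2 \<le> x)"
    using normal_far_left[OF assms] by force
  then show ?thesis by simp
qed

lemma normal_append: "normal (v @ w) \<Longrightarrow> normal w"
  by (simp add: successively_append_iff)

lemma ground_append_mono: "ground w \<subseteq> ground (v @ w)"
  by (induction v) auto

text \<open>A base piece added by \<open>v\<close> exceeds all earlier letters by at least 2, which
  \<open>z\<close> rules out for column \<open>c\<close>.\<close>

lemma ground_append_left:
  assumes "normal (v @ w)" "z \<in> set w" "c \<le> z + 1"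
  shows "c \<in> ground (v @ w) \<longleftrightarrow> c \<in> ground w"
  using assms
proof (induction v)
  case (Cons x v)
  have "normal (v @ w)" using Cons.prems(1) by (cases "v @ w") auto
  moreover have "\<not> (\<forall>z\<in>set (v @ w). z + 2 \<le> c)" using assms(2,3) by force
  ultimately show ?case
    using Cons ground_Cons_normal[of x "v @ w"] by (auto split: if_splits)
qed simp

section \<open>Counting the continuations of a word\<close>

definition run :: "nat \<Rightarrow> int set" where
  "run b = (\<lambda>i. 2 * int i) ` {..<b}"

lemma run_Suc: "run (Suc b) = insert (2 * int b) (run b)"
  by (auto simp: run_def lessThan_Suc)

lemma card_run: "card (run b) = b"
  by (simp add: run_def card_image inj_on_def)

lemma mem_run: "2 * int i \<in> run b \<longleftrightarrow> i < b"
  by (auto simp: run_def)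

lemma run_less: "c \<in> run b \<Longrightarrow> 0 \<le> c \<and> c + 2 \<le> 2 * int b"
  by (auto simp: run_def)

text \<open>\<open>u\<close> is the history; the letters \<open>v\<close> dropped after it stand in
  front because the latest letter comes first. So the last entry of \<open>v\<close> is the next
  letter.\<close>

definition conts :: "nat \<Rightarrow> nat \<Rightarrow> int list \<Rightarrow> int list set" where
  "conts b m u = {v. length v = m \<and> normal (v @ u) \<and> ground (v @ u) = run b}"

lemma conts_Suc: "conts b (Suc m) u = (\<Union>x. (\<lambda>v. v @ [x]) ` conts b m (x # u))"
proof (rule set_eqI)
  fix v :: "int list"
  show "v \<in> conts b (Suc m) u \<longleftrightarrow> v \<in> (\<Union>x. (\<lambda>v. v @ [x]) ` conts b m (x # u))"
    by (cases v rule: rev_cases) (auto simp: conts_def)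
qed

text \<open>The earlier letter \<open>z\<close> bars column \<open>c\<close> from joining the base
  later.\<close>

lemma conts_empty_missing:
  assumes "z \<in> set u" "c \<le> z + 1" "c \<notin> ground u" "c \<in> run b"
  shows "conts b m u = {}"
  using assms ground_append_left[of _ u z c] by (auto simp: conts_def)

lemma conts_empty_extra:
  assumes "c \<in> ground u" "c \<notin> run b"
  shows "conts b m u = {}"
  using assms ground_append_mono by (auto simp: conts_def)

lemma conts_empty_not_normal: "\<not> normal u \<Longrightarrow> conts b m u = {}"
  using normal_append by (auto simp: conts_def)

lemma card_conts_Suc:
  assumes "finite X" "\<And>x. x \<notin> X \<Longrightarrow> conts b m (x # u) = {}" "\<And>x. x \<in> X \<Longrightarrow> finite (conts b m (x # u))"
  shows "finite (conts b (Suc m) u)"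
    and "card (conts b (Suc m) u) = (\<Sum>x\<in>X. card (conts b m (x # u)))"
proof -
  have eq: "conts b (Suc m) u = (\<Union>x\<in>X. (\<lambda>v. v @ [x]) ` conts b m (x # u))"
    using assms(2) unfolding conts_Suc by blast
  show "finite (conts b (Suc m) u)" unfolding eq using assms by auto
  have "card (\<Union>x\<in>X. (\<lambda>v. v @ [x]) ` conts b m (x # u)) =
      (\<Sum>x\<in>X. card ((\<lambda>v. v @ [x]) ` conts b m (x # u)))"
    using assms by (intro card_UN_disjoint) auto
  then show "card (conts b (Suc m) u) = (\<Sum>x\<in>X. card (conts b m (x # u)))"
    unfolding eq by (simp add: card_image inj_on_def)
qed

text \<open>Hockey-stick identity for upper indices from \<open>N\<close> on; the extra summand
  accounts for the smaller ones.\<close>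

lemma sum_choose_shift:
  "(\<Sum>k\<le>h. (N + k) choose q) + (N choose Suc q) = (N + Suc h) choose Suc q"
  by (induction h) auto

text \<open>
  The state of a word: \<open>j\<close> base pieces placed, maximum \<open>M\<close>, last letter \<open>M - h\<close>.
  As long as base pieces are missing, \<open>M\<close> must be the last one placed, since a larger letter
  would support the next base piece.
\<close>

lemma card_conts:
  assumes "normal u" "u \<noteq> []" "ground u = run j" "j \<le> b" "0 < j"
    and "\<And>z. z \<in> set u \<Longrightarrow> z \<le> M" "M \<in> set u" "hd u = M - int h"
    and "j < b \<Longrightarrow> M = 2 * int j - 2" "2 * int j - 2 \<le> M"
  shows "finite (conts b m u) \<and>
    card (conts b m u) = (if b - j \<le> m then (2 * m + 1 + h) choose (m - (b - j)) else 0)"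
  using assms
proof (induction m arbitrary: u j M h)
  case 0
  have *: "conts b 0 u = {v. v = [] \<and> ground u = run b}"
    unfolding conts_def using 0(1) by (simp cong: conj_cong)
  show ?case
  proof (cases "j = b")
    case True
    then have "conts b 0 u = {[]}" using * 0(3) by simp
    then show ?thesis using True by simp
  next
    case False
    then have "run j \<noteq> run b" using card_run[of j] card_run[of b] by metis
    then have "conts b 0 u = {}" using * 0(3) by simp
    moreover have "\<not> b - j \<le> 0" using False 0(4) by simp
    ultimately show ?thesis by (simp only: if_False finite.emptyI card.empty simp_thms)
  qed
next
  case (Suc m)
  note u = Suc.prems
  define r where "r = b - j"
  \<comment> \<open>The only letter above \<open>M\<close> that can have continuations: the next
    base column while one is missing, as \<open>M + 1\<close> or anything larger would block it or
    skip it; afterwards \<open>M + 1\<close>, as larger letters would be extra base pieces.\<close>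
  define x0 where "x0 = (if j < b then M + 2 else M + 1)"
  \<comment> \<open>By normality the next letter is at least the last letter
    \<open>M - int h\<close> minus 1, hence the bound \<open>Suc h\<close>.\<close>
  define X where "X = insert x0 ((\<lambda>k. M - int k) ` {..Suc h})"
  have normal: "normal (x # u) \<longleftrightarrow> M - int h - 1 \<le> x" for x
    using u(1,2,8) by (auto simp: successively_Cons)
  have ground: "ground (x # u) = (if M + 2 \<le> x then {x} else {}) \<union> run j" if "M - int h - 1 \<le> x" for x
  proof -
    have "(\<forall>z\<in>set u. z + 2 \<le> x) \<longleftrightarrow> M + 2 \<le> x"
      using u(6,7) by (meson add_right_mono order_trans)
    then show ?thesis using ground_Cons_normal[of x u] normal that u(3) by simp
  qed
  \<comment> \<open>\<open>M - int k\<close> changes neither base nor maximum; the distance of the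
    last letter becomes \<open>k\<close>.\<close>
  have low: "finite (conts b m ((M - int k) # u))"
    "card (conts b m ((M - int k) # u)) = (if r \<le> m then (2 * m + 1 + k) choose (m - r) else 0)"
    if "k \<le> Suc h" for k
  proof -
    have "finite (conts b m ((M - int k) # u)) \<and> card (conts b m ((M - int k) # u)) =
      (if b - j \<le> m then (2 * m + 1 + k) choose (m - (b - j)) else 0)"
    proof (rule Suc.IH[of _ j M])
      show "normal ((M - int k) # u)" using normal that by simp
      show "ground ((M - int k) # u) = run j" using ground[of "M - int k"] that by simp
      show "z \<le> M" if "z \<in> set ((M - int k) # u)" for z using that u(6)[of z] by auto
    qed (use u(4,5,7,9,10) in auto)
    then show "finite (conts b m ((M - int k) # u))"
      "card (conts b m ((M - int k) # u)) = (if r \<le> m then (2 * m + 1 + k) choose (m - r) else 0)"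
      unfolding r_def by blast+
  qed
  \<comment> \<open>\<open>x0\<close> is the new maximum, so the distance becomes 0; for
    \<open>j < b\<close> there is also one missing base piece fewer.\<close>
  have high: "finite (conts b m (x0 # u)) \<and> card (conts b m (x0 # u)) =
     (if r = 0 then (2 * m + 1) choose m
      else if r \<le> Suc m then (2 * m + 1) choose (Suc m - r) else 0)"
  proof (cases "j < b")
    case True
    then have x0: "x0 = 2 * int j" "x0 = M + 2" using u(9) by (simp_all add: x0_def)
    have "finite (conts b m (x0 # u)) \<and> card (conts b m (x0 # u)) =
      (if b - Suc j \<le> m then (2 * m + 1 + 0) choose (m - (b - Suc j)) else 0)"
    proof (rule Suc.IH[of _ "Suc j" x0])
      show "normal (x0 # u)" using normal x0 by simp
      show "ground (x0 # u) = run (Suc j)" using ground[of x0] x0 by (simp add: run_Suc)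
      show "z \<le> x0" if "z \<in> set (x0 # u)" for z using that u(6)[of z] x0(2) by auto
    qed (use True x0(1) in auto)
    moreover have "(b - Suc j \<le> m) = (r \<le> Suc m)" "m - (b - Suc j) = Suc m - r" "r \<noteq> 0"
      using True by (auto simp: r_def)
    ultimately show ?thesis by simp
  next
    case False
    then have "j = b" using u(4) by simp
    have x0: "x0 = M + 1" using False by (simp add: x0_def)
    have "finite (conts b m (x0 # u)) \<and> card (conts b m (x0 # u)) =
      (if b - j \<le> m then (2 * m + 1 + 0) choose (m - (b - j)) else 0)"
    proof (rule Suc.IH[of _ j x0])
      show "normal (x0 # u)" using normal x0 by simp
      show "ground (x0 # u) = run j" using ground[of x0] x0 by simp
      show "z \<le> x0" if "z \<in> set (x0 # u)" for z using that u(6)[of z] x0 by auto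
    qed (use False u(4,5,10) x0 in auto)
    then show ?thesis using \<open>j = b\<close> by (simp add: r_def)
  qed
  have dead: "conts b m (x # u) = {}" if "x \<notin> X" for x
  proof (cases "M - int h - 1 \<le> x")
    case True
    have "x > M"
    proof (rule ccontr)
      assume "\<not> x > M"
      then have "x = M - int (nat (M - x))" "nat (M - x) \<le> Suc h" using True by auto
      then show False using that unfolding X_def by blast
    qed
    moreover have "x \<noteq> x0" using that by (simp add: X_def)
    ultimately show ?thesis
    proof (cases "j < b")
      case True
      then have M: "M = 2 * int j - 2" using u(9) by simp
      then have "x \<noteq> 2 * int j" "2 * int j \<le> x + 1"
        using \<open>x \<noteq> x0\<close> \<open>x > M\<close> True by (auto simp: x0_def)
      then show ?thesis
        using True mem_run[of j] ground[of x] \<open>M - int h - 1 \<le> x\<close>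
        by (intro conts_empty_missing[of x _ "2 * int j"]) auto
    next
      case False
      then have "M + 2 \<le> x" "x \<notin> run b"
        using \<open>x \<noteq> x0\<close> \<open>x > M\<close> u(4,10) run_less[of x b] by (auto simp: x0_def)
      then show ?thesis
        using ground[of x] True by (intro conts_empty_extra[of x]) auto
    qed
  next
    case False
    then show ?thesis using normal conts_empty_not_normal by blast
  qed
  have "finite X" by (simp add: X_def)
  have fin: "finite (conts b m (x # u))" if "x \<in> X" for x
    using that low(1) high unfolding X_def by auto
  have x0: "x0 \<notin> (\<lambda>k. M - int k) ` {..Suc h}" by (auto simp: x0_def)
  have "card (conts b (Suc m) u) = (\<Sum>x\<in>X. card (conts b m (x # u)))"
    using card_conts_Suc(2)[OF \<open>finite X\<close> dead fin] .
  also have "\<dots> = card (conts b m (x0 # u)) + (\<Sum>k\<le>Suc h. card (conts b m ((M - int k) # u)))"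
    unfolding X_def using x0 by (subst sum.insert) (simp_all add: sum.reindex inj_on_def del: sum.atMost_Suc)
  also have "(\<Sum>k\<le>Suc h. card (conts b m ((M - int k) # u))) =
      (if r \<le> m then \<Sum>k\<le>Suc h. (2 * m + 1 + k) choose (m - r) else 0)"
    using low(2) by (simp del: sum.atMost_Suc)
  also have "card (conts b m (x0 # u)) + \<dots> =
      (if r \<le> Suc m then (2 * Suc m + 1 + h) choose (Suc m - r) else 0)"
  proof (cases "r \<le> m")
    case True
    \<comment> \<open>For \<open>r = 0\<close> the term for \<open>x0\<close> has lower index
      \<open>m\<close>. By symmetry it may be read as \<open>Suc m\<close>, so in both cases it is
      the extra summand of the hockey-stick identity.\<close>
    have "(2 * m + 1) choose m = (2 * m + 1) choose Suc m"
      using binomial_symmetric[of m "2 * m + 1"] by simp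
    then have "card (conts b m (x0 # u)) = (2 * m + 1) choose (Suc (m - r))"
      using high True by (auto simp: Suc_diff_le)
    moreover have "2 * m + 1 + Suc (Suc h) = 2 * Suc m + 1 + h" by simp
    ultimately show ?thesis
      using sum_choose_shift[of "2 * m + 1" "m - r" "Suc h"] True
      by (simp add: Suc_diff_le add.commute del: sum.atMost_Suc binomial_Suc_Suc)
  next
    \<comment> \<open>Only \<open>x0\<close> can contribute now; for \<open>r = Suc m\<close> both
      sides are 1, beyond that 0.\<close>
    case False
    then show ?thesis using high by auto
  qed
  finally show ?case
    using card_conts_Suc(1)[OF \<open>finite X\<close> dead fin] unfolding r_def by blast
qed

text \<open>The first letter must be 0. It leaves \<open>n - 1\<close> letters to place from the
  state \<open>j = 1\<close>, \<open>M = 0\<close>, \<open>h = 0\<close>.\<close>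

lemma card_normal_words:
  assumes "0 < b" "b \<le> n"
  shows "card (conts b n []) = (2 * n - 1) choose (n - b)"
proof -
  obtain m where n: "n = Suc m" using assms by (cases n) auto
  have one: "finite (conts b m [0]) \<and> card (conts b m [0]) =
      (if b - 1 \<le> m then (2 * m + 1 + 0) choose (m - (b - 1)) else 0)"
    by (rule card_conts[of _ 1 _ 0]) (use assms in \<open>auto simp: run_def\<close>)
  \<comment> \<open>A negative first letter would be a base piece outside the run; a positive one
    would bar column 0 from the base.\<close>
  have dead: "conts b m [x] = {}" if "x \<notin> {0}" for x
  proof (cases "x < 0")
    case True
    then show ?thesis using run_less[of x b] by (intro conts_empty_extra[of x]) auto
  next
    case False
    then show ?thesis using that mem_run[of 0 b] assms by (intro conts_empty_missing[of x _ 0]) auto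
  qed
  have "card (conts b n []) = card (conts b m [0])"
    using card_conts_Suc(2)[of "{0}" b m "[]"] dead one unfolding n by simp
  moreover have "m - (b - 1) = n - b" "2 * m + 1 = 2 * n - 1" "b - 1 \<le> m"
    using n assms by auto
  ultimately show ?thesis using one by simp
qed

section \<open>Heaps with a prescribed base\<close>

definition run_heaps :: "nat \<Rightarrow> nat \<Rightarrow> int \<Rightarrow> cell set set" where
  "run_heaps n b a = {P. heap P \<and> card P = n \<and> {x. (x, 0) \<in> P} = (\<lambda>x. x + a) ` run b}"

text \<open>\<open>pile\<close> maps normal words bijectively onto heaps, turning length into number
  of pieces and \<open>ground\<close> into the level-0 columns.\<close>

lemma card_run_heaps:
  assumes "0 < b" "b \<le> n"
  shows "card (run_heaps n b 0) = (2 * n - 1) choose (n - b)"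
proof -
  have "run_heaps n b 0 = pile ` conts b n []"
  proof (intro equalityI subsetI)
    fix P assume P: "P \<in> run_heaps n b 0"
    then obtain w where w: "normal w" "pile w = P"
      using pile_surj unfolding run_heaps_def by blast
    then have "w \<in> conts b n []"
      using P ground_pile[of w] card_pile[of w] by (simp add: run_heaps_def conts_def)
    then show "P \<in> pile ` conts b n []" using w(2) by blast
  next
    fix P assume "P \<in> pile ` conts b n []"
    then obtain w where "P = pile w" "w \<in> conts b n []" by blast
    then show "P \<in> run_heaps n b 0"
      by (simp add: run_heaps_def conts_def heap_pile card_pile ground_pile)
  qed
  moreover have "inj_on pile (conts b n [])"
    by (intro inj_onI pile_inj) (simp_all add: conts_def)
  ultimately show ?thesis
    using card_normal_words[OF assms] by (simp add: card_image)
qed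

section \<open>Domino towers as heaps\<close>

definition dominoes :: "cell set \<Rightarrow> cell set set" where
  "dominoes P = (\<lambda>(x, y). domino x y) ` P"

definition shift :: "int \<Rightarrow> cell set \<Rightarrow> cell set" where
  "shift k P = (\<lambda>(x, y). (x + k, y)) ` P"

lemma domino_eq_iff [simp]: "domino x y = domino x' y' \<longleftrightarrow> x = x' \<and> y = y'"
  by (auto simp: domino_def doubleton_eq_iff)

lemma domino_in_dominoes [simp]: "domino x y \<in> dominoes P \<longleftrightarrow> (x, y) \<in> P"
  by (auto simp: dominoes_def)

lemma inj_domino: "inj_on (\<lambda>(x, y). domino x y) P"
  by (auto simp: inj_on_def)

lemma dominoes_inj [simp]: "dominoes P = dominoes Q \<longleftrightarrow> P = Q"
  by (metis domino_in_dominoes set_eqI surj_pair)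

lemma domino_disjoint_iff: "domino x y \<inter> domino x' y' = {} \<longleftrightarrow> \<not> (y = y' \<and> \<bar>x' - x\<bar> \<le> 1)"
proof -
  have "domino x y \<inter> domino x' y' \<noteq> {} \<longleftrightarrow> y = y' \<and> (x = x' \<or> x = x' + 1 \<or> x + 1 = x')"
    by (auto simp: domino_def)
  moreover have "(x = x' \<or> x = x' + 1 \<or> x + 1 = x') \<longleftrightarrow> \<bar>x' - x\<bar> \<le> 1"
    by arith
  ultimately show ?thesis by blast
qed

lemma disjoint_dominoes:
  "disjoint (dominoes P) \<longleftrightarrow>
    (\<forall>x x' y. (x, y) \<in> P \<longrightarrow> (x', y) \<in> P \<longrightarrow> \<bar>x' - x\<bar> \<le> 1 \<longrightarrow> x' = x)"
proof -
  have "disjoint (dominoes P) \<longleftrightarrow> (\<forall>x y x' y'. (x, y) \<in> P \<longrightarrow> (x', y') \<in> P \<longrightarrow>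
      domino x y \<noteq> domino x' y' \<longrightarrow> domino x y \<inter> domino x' y' = {})"
    unfolding disjoint_def dominoes_def by fastforce
  then show ?thesis unfolding domino_disjoint_iff domino_eq_iff by blast
qed

lemma base_dominoes: "base (dominoes P) = (\<lambda>x. domino x 0) ` {x. (x, 0) \<in> P}"
  by (auto simp: base_def)

text \<open>An interval has only one tiling by dominoes: its first cell must be a left cell, and
  each domino forces the next.\<close>

lemma Union_dominoes_eq_interval_iff:
  assumes "\<And>x x'. x \<in> X \<Longrightarrow> x' \<in> X \<Longrightarrow> \<bar>x' - x\<bar> \<le> 1 \<Longrightarrow> x' = x"
  shows "(\<Union>x\<in>X. domino x 0) = {a..<a + 2 * int b} \<times> {0} \<longleftrightarrow> X = (\<lambda>x. x + a) ` run b"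
proof -
  have mem: "(\<Union>x\<in>X. domino x 0) = {a..<a + 2 * int b} \<times> {0} \<longleftrightarrow>
      (\<forall>z. (z \<in> X \<or> z - 1 \<in> X) \<longleftrightarrow> a \<le> z \<and> z < a + 2 * int b)" for X
  proof -
    have "(\<Union>x\<in>X. domino x 0) = {z. z \<in> X \<or> z - 1 \<in> X} \<times> {0}"
      by (force simp: domino_def)
    then show ?thesis by (auto simp: times_eq_iff)
  qed
  show ?thesis
  proof
    assume "(\<Union>x\<in>X. domino x 0) = {a..<a + 2 * int b} \<times> {0}"
    then have *: "(z \<in> X \<or> z - 1 \<in> X) \<longleftrightarrow> a \<le> z \<and> z < a + 2 * int b" for z
      unfolding mem by blast
    have even: "a + 2 * int i \<in> X" if "i < b" for i
      using that
    proof (induction i)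
      case 0
      \<comment> \<open>A domino starting at \<open>a - 1\<close> would cover a cell outside the
        interval.\<close>
      then show ?case using *[of a] *[of "a - 1"] by auto
    next
      case (Suc i)
      then have "a + 2 * int i \<in> X" by simp
      then have "a + 2 * int i + 1 \<notin> X"
        using assms[of "a + 2 * int i" "a + 2 * int i + 1"] by auto
      moreover have "a + 2 * int (Suc i) \<in> X \<or> a + 2 * int i + 1 \<in> X"
        using *[of "a + 2 * int (Suc i)"] Suc.prems by (simp add: algebra_simps)
      ultimately show ?case by blast
    qed
    show "X = (\<lambda>x. x + a) ` run b"
    proof (intro equalityI subsetI)
      fix x assume x: "x \<in> X"
      then have le: "a \<le> x" "x < a + 2 * int b" using *[of x] by auto
      \<comment> \<open>\<open>i\<close> is the index of the tile covering cell \<open>x\<close>; a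
        piece starting at \<open>x\<close> overlaps that tile and so equals it.\<close>
      define i where "i = nat ((x - a) div 2)"
      have i: "i < b" "\<bar>x - (a + 2 * int i)\<bar> \<le> 1" using le unfolding i_def by linarith+
      then have "x = a + 2 * int i" using assms[OF even x] by simp
      then show "x \<in> (\<lambda>x. x + a) ` run b" using i(1) by (auto simp: run_def)
    next
      fix x assume "x \<in> (\<lambda>x. x + a) ` run b"
      then show "x \<in> X" using even by (auto simp: run_def add.commute)
    qed
  next
    assume X: "X = (\<lambda>x. x + a) ` run b"
    show "(\<Union>x\<in>X. domino x 0) = {a..<a + 2 * int b} \<times> {0}"
      unfolding mem
    proof (intro allI iffI)
      fix z assume "z \<in> X \<or> z - 1 \<in> X"
      then show "a \<le> z \<and> z < a + 2 * int b" unfolding X by (auto simp: run_def)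
    next
      fix z assume z: "a \<le> z \<and> z < a + 2 * int b"
      define i where "i = nat ((z - a) div 2)"
      have "i < b" "z = a + 2 * int i \<or> z - 1 = a + 2 * int i" using z unfolding i_def by linarith+
      then show "z \<in> X \<or> z - 1 \<in> X" unfolding X run_def by (auto simp: image_image add.commute)
    qed
  qed
qed

lemma ex_near_iff: "(\<exists>x'::int. \<bar>x' - x\<bar> \<le> 1 \<and> Q x') \<longleftrightarrow> Q (x - 1) \<or> Q x \<or> Q (x + 1)"
proof -
  have "\<bar>x' - x\<bar> \<le> 1 \<longleftrightarrow> x' = x - 1 \<or> x' = x \<or> x' = x + 1" for x' by arith
  then show ?thesis by auto
qed

text \<open>The clauses match: disjointness is separation on each level, the three support positions
  are the columns within distance 1, and the interval fixes the base up to an offset.\<close>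

lemma domino_tower_dominoes:
  "domino_tower n b (dominoes P) \<longleftrightarrow> (\<exists>a. P \<in> run_heaps n b a)"
proof -
  define X where "X = {x. (x, 0) \<in> P}"
  define sep where "sep \<longleftrightarrow> (\<forall>x x' y. (x, y) \<in> P \<longrightarrow> (x', y) \<in> P \<longrightarrow> \<bar>x' - x\<bar> \<le> 1 \<longrightarrow> x' = x)"
  have card_X: "card (base (dominoes P)) = card X"
    unfolding base_dominoes X_def by (intro card_image) (auto simp: inj_on_def)
  have fin: "finite (dominoes P) \<longleftrightarrow> finite P"
    unfolding dominoes_def by (rule finite_image_iff[OF inj_domino])
  have card: "card (dominoes P) = card P"
    unfolding dominoes_def by (rule card_image[OF inj_domino])
  \<comment> \<open>Separation makes the tiling of the interval unique; a translated run has
    \<open>b\<close> elements, which gives the cardinality.\<close>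
  have base: "card (base (dominoes P)) = b \<and> (\<exists>a. \<Union> (base (dominoes P)) = {a..<a + 2 * int b} \<times> {0})
      \<longleftrightarrow> (\<exists>a. X = (\<lambda>x. x + a) ` run b)" if sep
  proof -
    have "\<Union> (base (dominoes P)) = {a..<a + 2 * int b} \<times> {0} \<longleftrightarrow> X = (\<lambda>x. x + a) ` run b" for a
      unfolding base_dominoes X_def
      by (rule Union_dominoes_eq_interval_iff) (use that in \<open>unfold sep_def, blast\<close>)
    moreover have "card ((\<lambda>x. x + a) ` run b) = b" for a
      by (simp add: card_image card_run)
    ultimately show ?thesis unfolding card_X by metis
  qed
  have shape: "(\<forall>D\<in>dominoes P. \<exists>x y. D = domino x y) \<longleftrightarrow> True"
    unfolding dominoes_def by fast
  have not_base: "domino x y \<in> dominoes P - base (dominoes P) \<longleftrightarrow> (x, y) \<in> P \<and> y \<noteq> 0" for x y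
    by (auto simp: base_dominoes)
  define supp where "supp \<longleftrightarrow>
    (\<forall>x y. (x, y) \<in> P \<longrightarrow> 0 \<le> y \<and> (0 < y \<longrightarrow> (\<exists>x'. \<bar>x' - x\<bar> \<le> 1 \<and> (x', y - 1) \<in> P)))"
  have support: "(\<forall>x y. domino x y \<in> dominoes P - base (dominoes P) \<longrightarrow> y \<ge> 1 \<and>
        (domino (x - 1) (y - 1) \<in> dominoes P \<or> domino x (y - 1) \<in> dominoes P \<or>
         domino (x + 1) (y - 1) \<in> dominoes P)) \<longleftrightarrow> supp"
  proof -
    \<comment> \<open>On level 0 both implications hold trivially; elsewhere
      \<open>1 \<le> y\<close> and \<open>0 \<le> y\<close> agree.\<close>
    have "(A \<and> y \<noteq> 0 \<longrightarrow> y \<ge> 1 \<and> B) \<longleftrightarrow> (A \<longrightarrow> 0 \<le> y \<and> (0 < y \<longrightarrow> B))" for A B and y :: int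
      by (cases "y = 0") auto
    then show ?thesis unfolding not_base domino_in_dominoes supp_def ex_near_iff by (simp only:)
  qed
  have "domino_tower n b (dominoes P) \<longleftrightarrow>
      finite P \<and> card P = n \<and> sep \<and> supp \<and>
      (card (base (dominoes P)) = b \<and> (\<exists>a. \<Union> (base (dominoes P)) = {a..<a + 2 * int b} \<times> {0}))"
    unfolding domino_tower_def support disjoint_dominoes fin card shape sep_def by argo
  also have "\<dots> \<longleftrightarrow> finite P \<and> card P = n \<and> sep \<and> supp \<and> (\<exists>a. X = (\<lambda>x. x + a) ` run b)"
    using base by blast
  also have "\<dots> \<longleftrightarrow> heap P \<and> card P = n \<and> (\<exists>a. X = (\<lambda>x. x + a) ` run b)"
    unfolding heap_def supp_def sep_def by argo
  also have "\<dots> \<longleftrightarrow> (\<exists>a. P \<in> run_heaps n b a)"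
    unfolding run_heaps_def mem_Collect_eq X_def by simp
  finally show ?thesis .
qed

lemma domino_tower_eq_dominoes:
  assumes "domino_tower n b T"
  obtains P where "T = dominoes P"
proof
  show "T = dominoes {(x, y). domino x y \<in> T}"
    using assms unfolding domino_tower_def dominoes_def by force
qed

section \<open>Translation classes of towers\<close>

lemma htranslate_dominoes: "htranslate k (dominoes P) = dominoes (shift k P)"
  by (auto simp: htranslate_def dominoes_def shift_def domino_def image_image intro!: image_cong
      split: prod.splits)

lemma mem_shift [simp]: "(x, y) \<in> shift k P \<longleftrightarrow> (x - k, y) \<in> P"
  by (force simp: shift_def)

lemma shift_shift [simp]: "shift k (shift l P) = shift (k + l) P"
  by (auto simp: set_eq_iff algebra_simps)

lemma shift_0 [simp]: "shift 0 P = P"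
  by (auto simp: shift_def)

lemma heap_shift:
  assumes "heap P"
  shows "heap (shift k P)"
  unfolding heap_def
proof (intro conjI allI impI)
  show "finite (shift k P)" using heapD(1)[OF assms] by (simp add: shift_def)
next
  fix x y assume "(x, y) \<in> shift k P" "0 < y"
  then obtain x' where "\<bar>x' - (x - k)\<bar> \<le> 1" "(x', y - 1) \<in> P"
    using heapD(3)[OF assms, of "x - k" y] by auto
  then show "\<exists>x'. \<bar>x' - x\<bar> \<le> 1 \<and> (x', y - 1) \<in> shift k P"
    by (intro exI[of _ "x' + k"]) auto
qed (use heapD(2,4)[OF assms] in fastforce)+

lemma run_heaps_shift:
  assumes "P \<in> run_heaps n b a"
  shows "shift k P \<in> run_heaps n b (a + k)"
proof -
  have "card (shift k P) = card P"
    unfolding shift_def by (rule card_image) (auto simp: inj_on_def)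
  moreover have "{x. (x, 0) \<in> shift k P} = (\<lambda>x. x + k) ` {x. (x, 0) \<in> P}"
    by force
  ultimately show ?thesis
    using assms heap_shift by (auto simp: run_heaps_def image_image algebra_simps)
qed

text \<open>The offset is the smallest base column, since 0 is the least element of
  \<open>run b\<close>.\<close>

lemma run_heaps_offset_unique:
  assumes "0 < b" "P \<in> run_heaps n b a" "P \<in> run_heaps n b a'"
  shows "a = a'"
proof -
  have "0 \<in> run b" using mem_run[of 0 b] assms(1) by simp
  have "(\<lambda>x. x + a) ` run b = (\<lambda>x. x + a') ` run b"
    using assms(2,3) unfolding run_heaps_def by simp
  then have "a \<in> (\<lambda>x. x + a') ` run b" "a' \<in> (\<lambda>x. x + a) ` run b"
    using \<open>0 \<in> run b\<close> by force+
  then show ?thesis by (auto dest!: run_less)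
qed

lemma htranslation_rel_dominoes:
  "(dominoes P, T) \<in> htranslation_rel n b \<longleftrightarrow>
    (\<exists>a. P \<in> run_heaps n b a) \<and> (\<exists>k. T = dominoes (shift k P))"
  unfolding htranslation_rel_def
  by (auto simp: htranslate_dominoes domino_tower_dominoes; blast dest: run_heaps_shift)

text \<open>Every class contains exactly one tower whose base has offset 0.\<close>

lemma card_translation_classes:
  assumes "0 < b"
  shows "num_domino_towers b n = card (run_heaps n b 0)"
proof -
  define cls where "cls P = {dominoes (shift k P) | k. True}" for P
  have cls: "htranslation_rel n b `` {dominoes P} = cls P" if "P \<in> run_heaps n b a" for P a
    using that htranslation_rel_dominoes unfolding cls_def by fastforce
  have cls_shift: "cls (shift k P) = cls P" for k P
  proof (intro equalityI subsetI)
    fix T assume "T \<in> cls P"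
    then obtain l where "T = dominoes (shift l P)" unfolding cls_def by blast
    then have "T = dominoes (shift (l - k) (shift k P))" by simp
    then show "T \<in> cls (shift k P)" unfolding cls_def by blast
  qed (auto simp: cls_def)
  have inj: "inj_on cls (run_heaps n b 0)"
  proof (rule inj_onI)
    fix P Q assume P: "P \<in> run_heaps n b 0" and Q: "Q \<in> run_heaps n b 0" and eq: "cls P = cls Q"
    have "dominoes (shift 0 P) \<in> cls P" unfolding cls_def by blast
    then have "dominoes P \<in> cls Q" using eq by simp
    then obtain k where k: "P = shift k Q" unfolding cls_def by auto
    \<comment> \<open>\<open>shift k Q\<close> has offset \<open>k\<close>, whereas \<open>P\<close>
      has offset 0.\<close>
    then have "k = 0"
      using run_heaps_offset_unique[OF assms P] run_heaps_shift[OF Q, of k] by simp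
    then show "P = Q" using k by simp
  qed
  have "{T. domino_tower n b T} // htranslation_rel n b = cls ` run_heaps n b 0"
  proof (intro equalityI subsetI)
    fix C assume "C \<in> {T. domino_tower n b T} // htranslation_rel n b"
    then obtain T where T: "domino_tower n b T" "C = htranslation_rel n b `` {T}"
      by (auto elim: quotientE)
    obtain P where P: "T = dominoes P" using domino_tower_eq_dominoes[OF T(1)] .
    then obtain a where a: "P \<in> run_heaps n b a" using T(1) domino_tower_dominoes by blast
    \<comment> \<open>Shifting by \<open>- a\<close> moves the base to offset 0 within the
      class.\<close>
    have "C = cls (shift (- a) P)" using T(2) P cls[OF a] cls_shift by simp
    then show "C \<in> cls ` run_heaps n b 0" using run_heaps_shift[OF a, of "- a"] by auto
  next
    fix C assume "C \<in> cls ` run_heaps n b 0"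
    then obtain P where P: "P \<in> run_heaps n b 0" "C = htranslation_rel n b `` {dominoes P}"
      using cls by auto
    then have "domino_tower n b (dominoes P)" using domino_tower_dominoes by blast
    then show "C \<in> {T. domino_tower n b T} // htranslation_rel n b"
      using P(2) by (simp add: quotientI)
  qed
  then show ?thesis
    unfolding num_domino_towers_def using inj by (simp add: card_image)
qed

theorem theorem2p2:
  fixes n b :: nat
  assumes "b \<ge> 1" and "n \<ge> b"
  shows "num_domino_towers b n = (2 * n - 1) choose (n - b)"
  using card_translation_classes[of b n] card_run_heaps[of b n] assms by simp

end
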